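(* Assume that $d^\pi(s)>0$ for all $s\in\mathcal S$ and all $\pi\in\operatorname{int}(\Delta_{\mathcal A}^{\mathcal S})$. Then for all $\pi\in\operatorname{int}(\Delta_{\mathcal A}^{\mathcal S})$, $s\in\mathcal S$ and $a\in\mathcal A$, $$\nabla^{\mathrm K}R(\pi)(s,a)=(1-\gamma)^{-1}A^{\pi}(s,a)\,\pi(a|s).$$
   Context: $\mathcal S$ (states) and $\mathcal A$ (actions) are finite nonempty sets. For a finite set $X$, $\Delta_X$ is the simplex of probability vectors on $X$. A policy is an element $\pi\in\Delta_{\mathcal A}^{\mathcal S}$ with entries $\pi(a|s)$, $\pi(\cdot|s)\in\Delta_{\mathcal A}$; $\operatorname{int}$ denotes the relative interior, so $\operatorname{int}(\Delta_{\mathcal A}^{\mathcal S})$ is the set of policies with all entries positive; the tangent space is $T\Delta_{\mathcal A}^{\mathcal S}=\{w\in\mathbb R^{\mathcal S\times\mathcal A}:\sum_a w(s,a)=0\ \forall s\}$. Fixed data: a transition kernel $P(s'|s,a)$, a reward vector $r\in\mathbb R^{\mathcal S\times\mathcal A}$, a discount factor $\gamma\in[0,1)$, an initial distribution $\mu\in\Delta_{\mathcal S}$. Under $\pi$ the process is $S_0\sim\mu$, $A_t\sim\pi(\cdot|S_t)$, $S_{t+1}\sim P(\cdot|S_t,A_t)$, with law $\mathbb P^{\pi,\mu}$. Define (sums over $t\ge 0$) - reward $R(\pi)=R^\mu(\pi)=(1-\gamma)\,\mathbb E_{\mathbb P^{\pi,\mu}}[\sum_t\gamma^t r(S_t,A_t)]$;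 - $V^\pi(s)=R^{\delta_s}(\pi)$, $Q^\pi(s,a)=(1-\gamma)r(s,a)+\gamma\sum_{s'}V^\pi(s')P(s'|s,a)$, $A^\pi(s,a)=Q^\pi(s,a)-V^\pi(s)$; - $d^\pi(s)=(1-\gamma)\sum_t\gamma^t\,\mathbb P^{\pi,\mu}(S_t=s)$. The Kakade metric is the Riemannian metric on $\operatorname{int}(\Delta_{\mathcal A}^{\mathcal S})$ given by $g^{\mathrm K}_\pi(w_1,w_2)=\sum_s d^\pi(s)\sum_a\frac{w_1(s,a)w_2(s,a)}{\pi(a|s)}$ for $w_1,w_2\in T\Delta_{\mathcal A}^{\mathcal S}$. $\nabla^{\mathrm K}R(\pi)\in T\Delta_{\mathcal A}^{\mathcal S}$ is the Riemannian gradient: $g^{\mathrm K}_\pi(\nabla^{\mathrm K}R(\pi),w)=\partial_wR(\pi)$ for all $w\in T\Delta_{\mathcal A}^{\mathcal S}$. *)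

theory Defs
  imports "HOL-Probability.Probability"
begin

text \<open>
  States and actions are finite types \<open>'s\<close> and \<open>'a\<close>. Elements of the space of real-valued functions
  on pairs (state, action) are vectors of type \<open>real ^ 'a ^ 's\<close>; in particular \<open>\<pi>(a|s)\<close> is
  \<open>\<pi> $ s $ a\<close> and \<open>r(s,a)\<close> is \<open>r $ s $ a\<close>. The transition probability \<open>P(s'|s,a)\<close> is
  \<open>pmf (P s a) s'\<close>.
\<close>

definition policies :: "(real ^ 'a ^ 's) set" where
  "policies = {\<pi>. \<forall>s. (\<forall>a. 0 \<le> \<pi> $ s $ a) \<and> (\<Sum>a\<in>UNIV. \<pi> $ s $ a) = 1}"

abbreviation int_policies :: "(real ^ 'a ^ 's) set" where
  "int_policies \<equiv> rel_interior policies"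

definition tangent_space :: "(real ^ 'a ^ 's) set" where
  "tangent_space = {w. \<forall>s. (\<Sum>a\<in>UNIV. w $ s $ a) = 0}"


subsection \<open>The controlled process\<close>

text \<open>The joint law of a pair \<open>(S, A)\<close> with \<open>S \<sim> p\<close> and \<open>A \<sim> \<pi>(\<cdot>|S)\<close>. It is a probability measure
  if \<open>\<pi>\<close> is a policy.\<close>

definition state_action_law :: "real ^ 'a ^ 's \<Rightarrow> 's pmf \<Rightarrow> ('s \<times> 'a) measure" where
  "state_action_law \<pi> p = point_measure UNIV (\<lambda>(s, a). ennreal (pmf p s * \<pi> $ s $ a))"

text \<open>The conditional law of \<open>(S\<^sub>t, A\<^sub>t)\<close> given the trajectory \<open>\<omega>\<close> before time \<open>t\<close>.\<close>

primrec step_kernel ::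
  "('s \<Rightarrow> 'a \<Rightarrow> 's pmf) \<Rightarrow> 's pmf \<Rightarrow> real ^ 'a ^ 's \<Rightarrow> nat \<Rightarrow> (nat \<Rightarrow> 's \<times> 'a) \<Rightarrow> ('s \<times> 'a) measure"
where
  "step_kernel P \<mu> \<pi> 0 = (\<lambda>\<omega>. state_action_law \<pi> \<mu>)"
| "step_kernel P \<mu> \<pi> (Suc t) = (\<lambda>\<omega>. state_action_law \<pi> (P (fst (\<omega> t)) (snd (\<omega> t))))"

text \<open>The law of the process \<open>(S\<^sub>t, A\<^sub>t)\<^sub>t\<close> on the space of infinite trajectories, by the Ionescu-Tulcea
  theorem; \<open>S\<^sub>t\<close> and \<open>A\<^sub>t\<close> are \<open>fst (\<omega> t)\<close> and \<open>snd (\<omega> t)\<close>. It is meaningful only for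
  policies \<open>\<pi>\<close> (see \<open>Ionescu_Tulcea_step_kernel\<close> below).\<close>

definition trajectory_law ::
  "('s \<Rightarrow> 'a \<Rightarrow> 's pmf) \<Rightarrow> 's pmf \<Rightarrow> real ^ 'a ^ 's \<Rightarrow> (nat \<Rightarrow> 's \<times> 'a) measure" where
  "trajectory_law P \<mu> \<pi> =
    projective_family.lim UNIV
      (Ionescu_Tulcea.CI (step_kernel P \<mu> \<pi>) (\<lambda>_. count_space UNIV)) (\<lambda>_. count_space UNIV)"

lemma prob_space_state_action_law:
  fixes \<pi> :: "real ^ 'a ^ 's"
  assumes "\<pi> \<in> policies"
  shows "prob_space (state_action_law \<pi> p)"
proof
  have nonneg: "0 \<le> \<pi> $ s $ a" and sum: "(\<Sum>a\<in>UNIV. \<pi> $ s $ a) = 1" for s a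
    using assms by (auto simp: policies_def)
  have "(\<Sum>x\<in>UNIV. ennreal (pmf p (fst x) * \<pi> $ fst x $ snd x))
      = ennreal (\<Sum>x\<in>UNIV. pmf p (fst x) * \<pi> $ fst x $ snd x)"
    by (intro sum_ennreal) (simp add: nonneg)
  also have "(\<Sum>x\<in>UNIV. pmf p (fst x) * \<pi> $ fst x $ snd x)
      = (\<Sum>s\<in>UNIV. \<Sum>a\<in>UNIV. pmf p s * \<pi> $ s $ a)"
    unfolding UNIV_Times_UNIV[symmetric] by (simp add: sum.cartesian_product case_prod_beta)
  also have "\<dots> = 1"
    by (simp add: sum_distrib_left[symmetric] sum sum_pmf_eq_1)
  finally show "emeasure (state_action_law \<pi> p) (space (state_action_law \<pi> p)) = 1"
    by (simp add: state_action_law_def space_point_measure emeasure_point_measure_finite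
        case_prod_beta)
qed

lemma Ionescu_Tulcea_step_kernel:
  fixes \<pi> :: "real ^ 'a ^ 's"
  assumes \<pi>: "\<pi> \<in> policies"
  shows "Ionescu_Tulcea (step_kernel P \<mu> \<pi>) (\<lambda>_. count_space UNIV)"
proof (rule Ionescu_Tulcea.intro)
  have law: "state_action_law \<pi> p \<in> space (subprob_algebra (count_space UNIV))" for p
    using prob_space_state_action_law[OF \<pi>]
    by (auto simp: space_subprob_algebra state_action_law_def sets_point_measure
        intro: prob_space_imp_subprob_space)
  show "step_kernel P \<mu> \<pi> i
      \<in> measurable (PiM {0..<i} (\<lambda>_. count_space UNIV)) (subprob_algebra (count_space UNIV))" for i
  proof (cases i)
    case 0
    then show ?thesis by (simp add: law)
  next
    case (Suc t)
    have "(\<lambda>\<omega>. \<omega> t) \<in> measurable (PiM {0..<Suc t} (\<lambda>_. count_space (UNIV :: ('s \<times> 'a) set)))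
        (count_space UNIV)"
      by (rule measurable_component_singleton) simp
    moreover have "(\<lambda>x. state_action_law \<pi> (P (fst x) (snd x)))
        \<in> measurable (count_space UNIV) (subprob_algebra (count_space UNIV))"
      by (simp add: law)
    ultimately show ?thesis
      unfolding Suc step_kernel.simps by (rule measurable_compose)
  qed
  show "prob_space (step_kernel P \<mu> \<pi> i x)"
    if "x \<in> space (PiM {0..<i} (\<lambda>_. count_space UNIV))" for i x
    by (cases i) (simp_all add: prob_space_state_action_law[OF \<pi>])
qed


subsection \<open>Rewards, value functions, and state frequencies\<close>

definition reward ::
  "('s \<Rightarrow> 'a \<Rightarrow> 's pmf) \<Rightarrow> real ^ 'a ^ 's \<Rightarrow> real \<Rightarrow> 's pmf \<Rightarrow> real ^ 'a ^ 's \<Rightarrow> real" where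
  "reward P r \<gamma> \<mu> \<pi> =
    (1 - \<gamma>) * (\<integral>\<omega>. (\<Sum>t. \<gamma> ^ t * r $ fst (\<omega> t) $ snd (\<omega> t)) \<partial>trajectory_law P \<mu> \<pi>)"

definition state_value ::
  "('s \<Rightarrow> 'a \<Rightarrow> 's pmf) \<Rightarrow> real ^ 'a ^ 's \<Rightarrow> real \<Rightarrow> real ^ 'a ^ 's \<Rightarrow> 's \<Rightarrow> real" where
  "state_value P r \<gamma> \<pi> s = reward P r \<gamma> (return_pmf s) \<pi>"

definition action_value ::
  "('s \<Rightarrow> 'a \<Rightarrow> 's pmf) \<Rightarrow> real ^ 'a ^ 's \<Rightarrow> real \<Rightarrow> real ^ 'a ^ 's \<Rightarrow> 's \<Rightarrow> 'a \<Rightarrow> real" where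
  "action_value P r \<gamma> \<pi> s a =
    (1 - \<gamma>) * r $ s $ a + \<gamma> * (\<Sum>s'\<in>UNIV. state_value P r \<gamma> \<pi> s' * pmf (P s a) s')"

definition advantage ::
  "('s \<Rightarrow> 'a \<Rightarrow> 's pmf) \<Rightarrow> real ^ 'a ^ 's \<Rightarrow> real \<Rightarrow> real ^ 'a ^ 's \<Rightarrow> 's \<Rightarrow> 'a \<Rightarrow> real" where
  "advantage P r \<gamma> \<pi> s a = action_value P r \<gamma> \<pi> s a - state_value P r \<gamma> \<pi> s"

definition state_frequency ::
  "('s \<Rightarrow> 'a \<Rightarrow> 's pmf) \<Rightarrow> real \<Rightarrow> 's pmf \<Rightarrow> real ^ 'a ^ 's \<Rightarrow> 's \<Rightarrow> real" where
  "state_frequency P \<gamma> \<mu> \<pi> s =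
    (1 - \<gamma>) * (\<Sum>t. \<gamma> ^ t *
      measure (trajectory_law P \<mu> \<pi>) {\<omega> \<in> space (trajectory_law P \<mu> \<pi>). fst (\<omega> t) = s})"


subsection \<open>The Kakade metric and gradient\<close>

definition kakade_metric ::
  "('s \<Rightarrow> 'a \<Rightarrow> 's pmf) \<Rightarrow> real \<Rightarrow> 's pmf \<Rightarrow> real ^ 'a ^ 's \<Rightarrow> real ^ 'a ^ 's \<Rightarrow> real ^ 'a ^ 's \<Rightarrow> real"
where
  "kakade_metric P \<gamma> \<mu> \<pi> w\<^sub>1 w\<^sub>2 =
    (\<Sum>s\<in>UNIV. state_frequency P \<gamma> \<mu> \<pi> s *
      (\<Sum>a\<in>UNIV. w\<^sub>1 $ s $ a * w\<^sub>2 $ s $ a / \<pi> $ s $ a))"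

text \<open>The Riemannian gradient \<open>v\<close> is characterized by \<open>g\<^sub>\<pi>(v, w) = \<partial>\<^sub>w R(\<pi>)\<close> for all tangent
  vectors \<open>w\<close>; the directional derivative \<open>\<partial>\<^sub>w R(\<pi>)\<close> is required to exist. For \<open>\<pi>\<close> in the interior
  and \<open>t\<close> near 0, \<open>\<pi> + t w\<close> is again a policy, so the derivative does not depend on the
  (meaningless) values of \<open>reward\<close> outside the set of policies.\<close>

definition is_kakade_gradient ::
  "('s \<Rightarrow> 'a \<Rightarrow> 's pmf) \<Rightarrow> real ^ 'a ^ 's \<Rightarrow> real \<Rightarrow> 's pmf \<Rightarrow> real ^ 'a ^ 's \<Rightarrow> real ^ 'a ^ 's \<Rightarrow> bool"
where
  "is_kakade_gradient P r \<gamma> \<mu> \<pi> v \<longleftrightarrow>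
    v \<in> tangent_space \<and>
    (\<forall>w\<in>tangent_space.
      ((\<lambda>t. reward P r \<gamma> \<mu> (\<pi> + t *\<^sub>R w)) has_real_derivative kakade_metric P \<gamma> \<mu> \<pi> v w) (at 0))"

definition kakade_gradient ::
  "('s \<Rightarrow> 'a \<Rightarrow> 's pmf) \<Rightarrow> real ^ 'a ^ 's \<Rightarrow> real \<Rightarrow> 's pmf \<Rightarrow> real ^ 'a ^ 's \<Rightarrow> real ^ 'a ^ 's"
where
  "kakade_gradient P r \<gamma> \<mu> \<pi> = (THE v. is_kakade_gradient P r \<gamma> \<mu> \<pi> v)"

end

theory Submission
  imports Defs
begin

text \<open>
  Let \<open>\<pi>\<close> and \<open>\<pi>'\<close> be policies. The proof rests on the performance difference formula
  \<open>(1 - \<gamma>) (R(\<pi>') - R(\<pi>)) = \<Sum>\<^sub>s d\<^sup>\<pi>\<^sup>'(s) \<Sum>\<^sub>a \<pi>'(a|s) A\<^sup>\<pi>(s, a)\<close>, an exact identity that is linear in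
  \<open>\<pi>'\<close> except for the weights \<open>d\<^sup>\<pi>\<^sup>'\<close> (\<open>performance_difference\<close>). For \<open>\<pi>' = \<pi> + t w\<close> with \<open>w\<close> tangent,
  the Bellman equation says that \<open>\<Sum>\<^sub>a \<pi>(a|s) A\<^sup>\<pi>(s, a) = 0\<close>, so the inner sum is
  \<open>t \<Sum>\<^sub>a w(s, a) A\<^sup>\<pi>(s, a)\<close>. After division by \<open>t\<close>, only the continuity of \<open>d\<close> in the policy is needed
  to obtain \<open>\<partial>\<^sub>w R(\<pi>) = (1 - \<gamma>)\<^sup>-\<^sup>1 \<Sum>\<^sub>s d\<^sup>\<pi>(s) \<Sum>\<^sub>a w(s, a) A\<^sup>\<pi>(s, a)\<close> (\<open>policy_gradient\<close>); the weights never
  have to be differentiated. The right-hand side is the Kakade product of \<open>w\<close> with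
  \<open>(1 - \<gamma>)\<^sup>-\<^sup>1 A\<^sup>\<pi>(s, a) \<pi>(a|s)\<close>, since the metric divides by \<open>\<pi>(a|s)\<close>. This vector is tangent, again by
  the Bellman equation, and it is the only candidate because positive state frequencies make the metric
  definite.

  The process enters through its one-dimensional marginals alone. The state law evolves by a linear
  map, so that \<open>R\<close> and \<open>d\<close> become discounted sums of iterates of that map (\<open>occupancy\<close>), and
  two ways of splitting off one step of the iteration give what remains: splitting at the end
  gives the flow equation of \<open>d\<^sup>\<pi>\<^sup>'\<close>, which makes the sum in the performance difference formula telescope,
  and splitting at the start gives the Bellman equation.
\<close>

section \<open>One-step disintegration of an Ionescu-Tulcea limit\<close>

lemma (in Ionescu_Tulcea) CI_initial_segment:
  "CI {0..<n} = C 0 n (\<lambda>_. undefined)"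
proof (rule measure_eqI)
  show "sets (CI {0..<n}) = sets (C 0 n (\<lambda>_. undefined))"
    by (simp add: CI_def sets_C space_PiM)
  fix X assume "X \<in> sets (CI {0..<n})"
  then have X: "X \<in> sets (PiM {0..<n} M)"
    by (simp add: CI_def)
  then have "prod_emb {0..<n} M {0..<n} X = X"
    using sets.sets_into_space[OF X] by (simp add: prod_emb_id space_PiM)
  then show "emeasure (CI {0..<n}) X = emeasure (C 0 n (\<lambda>_. undefined)) X"
    using emeasure_CI[of "{0..<n}" n X] X by simp
qed

lemma (in Ionescu_Tulcea) nn_integral_lim_initial_segment:
  assumes [measurable]: "f \<in> borel_measurable (PiM {0..<n} M)"
  shows "(\<integral>\<^sup>+\<omega>. f (restrict \<omega> {0..<n}) \<partial>PF.lim) = (\<integral>\<^sup>+\<omega>. f \<omega> \<partial>C 0 n (\<lambda>_. undefined))"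
proof -
  have "(\<lambda>\<omega>. restrict \<omega> {0..<n}) \<in> measurable PF.lim (PiM {0..<n} M)"
    by (simp add: measurable_cong_sets[OF PF.sets_lim refl] measurable_restrict_subset)
  then show ?thesis
    unfolding CI_initial_segment[symmetric] distr_lim[OF finite_atLeastLessThan, symmetric]
    by (simp add: nn_integral_distr)
qed

text \<open>The law of coordinate \<open>n\<close> is the mean of its conditional laws given the past. The mean is
  taken over the whole process, so that for a Markov kernel the formula is a recursion between
  consecutive marginals of one and the same measure.\<close>

lemma (in Ionescu_Tulcea) nn_integral_lim_component:
  assumes f[measurable]: "f \<in> borel_measurable (M n)"
  shows "(\<integral>\<^sup>+\<omega>. f (\<omega> n) \<partial>PF.lim)
    = (\<integral>\<^sup>+\<omega>. (\<integral>\<^sup>+x. f x \<partial>P n (restrict \<omega> {0..<n})) \<partial>PF.lim)"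
proof -
  let ?C = "\<lambda>n. C 0 n (\<lambda>_. undefined)"
  have "(\<integral>\<^sup>+\<omega>. f (\<omega> n) \<partial>PF.lim) = (\<integral>\<^sup>+\<omega>. f (restrict \<omega> {0..<Suc n} n) \<partial>PF.lim)"
    by simp
  also have "\<dots> = (\<integral>\<^sup>+\<omega>. f (\<omega> n) \<partial>?C (Suc n))"
    by (rule nn_integral_lim_initial_segment) measurable
  also have "\<dots> = (\<integral>\<^sup>+\<omega>. (\<integral>\<^sup>+\<omega>'. f (\<omega>' n) \<partial>eP n \<omega>) \<partial>?C n)"
    by (simp, subst nn_integral_bind[where B="PiM {0..<Suc n} M"])
       (auto simp: measurable_cong_sets[OF sets_C] space_PiM)
  also have "\<dots> = (\<integral>\<^sup>+\<omega>. (\<integral>\<^sup>+x. f x \<partial>P n \<omega>) \<partial>?C n)"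
    by (intro nn_integral_cong, subst nn_integral_eP) (auto simp: space_C space_PiM)
  also have "\<dots> = (\<integral>\<^sup>+\<omega>. (\<integral>\<^sup>+x. f x \<partial>P n (restrict \<omega> {0..<n})) \<partial>PF.lim)"
    by (rule nn_integral_lim_initial_segment[symmetric]) measurable
  finally show ?thesis .
qed

section \<open>State laws and discounted occupancies\<close>

text \<open>The map acts on arbitrary vectors rather than on \<^typ>\<open>'s pmf\<close>, so that it can be applied to
  series of state laws, term by term.\<close>

definition transition ::
  "('s \<Rightarrow> 'a \<Rightarrow> 's pmf) \<Rightarrow> real ^ 'a ^ 's \<Rightarrow> ('s \<Rightarrow> real) \<Rightarrow> 's \<Rightarrow> real" where
  "transition P \<pi> p s' = (\<Sum>s\<in>UNIV. p s * (\<Sum>a\<in>UNIV. \<pi> $ s $ a * pmf (P s a) s'))"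

definition state_law ::
  "('s \<Rightarrow> 'a \<Rightarrow> 's pmf) \<Rightarrow> real ^ 'a ^ 's \<Rightarrow> ('s \<Rightarrow> real) \<Rightarrow> nat \<Rightarrow> 's \<Rightarrow> real" where
  "state_law P \<pi> p t = (transition P \<pi> ^^ t) p"

definition occupancy ::
  "('s \<Rightarrow> 'a \<Rightarrow> 's pmf) \<Rightarrow> real \<Rightarrow> real ^ 'a ^ 's \<Rightarrow> ('s \<Rightarrow> real) \<Rightarrow> 's \<Rightarrow> real" where
  "occupancy P \<gamma> \<pi> p s = (1 - \<gamma>) * (\<Sum>t. \<gamma> ^ t * state_law P \<pi> p t s)"

definition prob_vector :: "('s::finite \<Rightarrow> real) \<Rightarrow> bool" where
  "prob_vector p \<longleftrightarrow> (\<forall>s. 0 \<le> p s) \<and> (\<Sum>s\<in>UNIV. p s) = 1"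

lemma prob_vector_pmf: "prob_vector (pmf p)"
  by (simp add: prob_vector_def sum_pmf_eq_1)

lemma prob_vector_le_1: "prob_vector p \<Longrightarrow> p s \<le> 1"
  unfolding prob_vector_def by (metis UNIV_I finite member_le_sum)

lemma prob_vector_transition:
  assumes "\<pi> \<in> policies" "prob_vector p"
  shows "prob_vector (transition P \<pi> p)"
proof -
  have "(\<Sum>s'\<in>UNIV. transition P \<pi> p s')
      = (\<Sum>s\<in>UNIV. p s * (\<Sum>a\<in>UNIV. \<pi> $ s $ a * (\<Sum>s'\<in>UNIV. pmf (P s a) s')))"
    unfolding transition_def sum_distrib_left
    by (subst sum.swap, intro sum.cong refl, subst sum.swap) simp
  also have "\<dots> = 1"
    using assms by (simp add: sum_pmf_eq_1 policies_def prob_vector_def)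
  finally show ?thesis
    using assms by (auto simp: prob_vector_def transition_def policies_def intro!: sum_nonneg mult_nonneg_nonneg)
qed

lemma prob_vector_state_law:
  "\<pi> \<in> policies \<Longrightarrow> prob_vector p \<Longrightarrow> prob_vector (state_law P \<pi> p t)"
  by (induction t) (simp_all add: state_law_def prob_vector_transition)

lemma state_law_simps:
  "state_law P \<pi> p 0 = p"
  "state_law P \<pi> p (Suc t) = transition P \<pi> (state_law P \<pi> p t)"
  by (simp_all add: state_law_def)

lemma state_law_shift: "state_law P \<pi> p (Suc t) = state_law P \<pi> (transition P \<pi> p) t"
  by (simp add: state_law_def funpow_swap1)

text \<open>The state law is linear in the initial distribution. This is what allows value functions, which
  are defined by point masses, to represent the reward of any initial distribution.\<close>

lemma state_law_mixture:
  fixes p :: "'s::finite \<Rightarrow> real" and \<pi> :: "real ^ 'a::finite ^ 's"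
  shows "state_law P \<pi> p t s' = (\<Sum>s\<in>UNIV. p s * state_law P \<pi> (pmf (return_pmf s)) t s')"
proof (induction t arbitrary: s')
  case 0
  show ?case
    by (simp add: state_law_simps pmf_return indicator_def if_distrib[of "\<lambda>x. p _ * x"] eq_commute
        sum.delta cong: if_cong)
next
  case (Suc t)
  define k where "k s = (\<Sum>a\<in>UNIV. \<pi> $ s $ a * pmf (P s a) s')" for s
  show ?case
    unfolding state_law_simps transition_def k_def[symmetric]
    by (subst Suc, simp only: sum_distrib_right sum_distrib_left, subst sum.swap)
       (simp add: mult_ac)
qed

lemma norm_discounted_state_law_le:
  assumes "0 \<le> \<gamma>" "\<pi> \<in> policies" "prob_vector p"
  shows "norm (\<gamma> ^ t * state_law P \<pi> p t s) \<le> \<gamma> ^ t"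
proof -
  note pv = prob_vector_state_law[OF assms(2,3), of P t]
  show ?thesis
    using pv prob_vector_le_1[OF pv, of s] assms(1)
    by (simp add: abs_mult mult_left_le prob_vector_def)
qed

lemma summable_discounted_state_law:
  assumes "0 \<le> \<gamma>" "\<gamma> < 1" "\<pi> \<in> policies" "prob_vector p"
  shows "summable (\<lambda>t. \<gamma> ^ t * state_law P \<pi> p t s)"
proof (rule summable_comparison_test'[of "\<lambda>t. \<gamma> ^ t"])
  show "summable (\<lambda>t. \<gamma> ^ t)"
    using assms by (simp add: summable_geometric)
qed (intro norm_discounted_state_law_le assms)

lemma sums_occupancy:
  assumes "0 \<le> \<gamma>" "\<gamma> < 1" "\<pi> \<in> policies" "prob_vector p"
  shows "(\<lambda>t. (1 - \<gamma>) * (\<gamma> ^ t * state_law P \<pi> p t s)) sums occupancy P \<gamma> \<pi> p s"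
  unfolding occupancy_def
  by (intro sums_mult summable_sums summable_discounted_state_law assms)

text \<open>The last step of each iterate is split off here: discounting shifts the series by one, and the
  transition map is applied to the occupancy itself.\<close>

lemma occupancy_flow:
  fixes \<pi> :: "real ^ 'a::finite ^ 's::finite"
  assumes "0 \<le> \<gamma>" "\<gamma> < 1" "\<pi> \<in> policies" "prob_vector p"
  shows "occupancy P \<gamma> \<pi> p s = (1 - \<gamma>) * p s + \<gamma> * transition P \<pi> (occupancy P \<gamma> \<pi> p) s"
proof -
  note sums = sums_occupancy[OF assms]
  have "(\<lambda>t. (1 - \<gamma>) * (\<gamma> ^ Suc t * state_law P \<pi> p (Suc t) s))
      = (\<lambda>t. \<gamma> * transition P \<pi> (\<lambda>s. (1 - \<gamma>) * (\<gamma> ^ t * state_law P \<pi> p t s)) s)"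
    by (simp add: fun_eq_iff state_law_simps transition_def sum_distrib_left mult_ac)
  also have "\<dots> sums (\<gamma> * transition P \<pi> (occupancy P \<gamma> \<pi> p) s)"
    unfolding transition_def by (intro sums_mult sums_sum sums_mult2 sums)
  finally have "(\<lambda>t. (1 - \<gamma>) * (\<gamma> ^ t * state_law P \<pi> p t s)) sums
      (\<gamma> * transition P \<pi> (occupancy P \<gamma> \<pi> p) s + (1 - \<gamma>) * (\<gamma> ^ 0 * state_law P \<pi> p 0 s))"
    by (rule sums_Suc)
  from sums_unique2[OF sums this] show ?thesis
    by (simp add: state_law_simps)
qed

text \<open>Here the first step is split off instead, and the transition map is applied to the initial
  distribution.\<close>

lemma occupancy_first_step:
  fixes \<pi> :: "real ^ 'a::finite ^ 's::finite"
  assumes "0 \<le> \<gamma>" "\<gamma> < 1" "\<pi> \<in> policies" "prob_vector p"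
  shows "occupancy P \<gamma> \<pi> p s = (1 - \<gamma>) * p s + \<gamma> * occupancy P \<gamma> \<pi> (transition P \<pi> p) s"
proof -
  have "(\<lambda>t. (1 - \<gamma>) * (\<gamma> ^ Suc t * state_law P \<pi> p (Suc t) s))
      = (\<lambda>t. \<gamma> * ((1 - \<gamma>) * (\<gamma> ^ t * state_law P \<pi> (transition P \<pi> p) t s)))"
    by (simp add: fun_eq_iff state_law_shift mult_ac)
  also have "\<dots> sums (\<gamma> * occupancy P \<gamma> \<pi> (transition P \<pi> p) s)"
    by (intro sums_mult sums_occupancy assms prob_vector_transition)
  finally have "(\<lambda>t. (1 - \<gamma>) * (\<gamma> ^ t * state_law P \<pi> p t s)) sums
      (\<gamma> * occupancy P \<gamma> \<pi> (transition P \<pi> p) s + (1 - \<gamma>) * (\<gamma> ^ 0 * state_law P \<pi> p 0 s))"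
    by (rule sums_Suc)
  from sums_unique2[OF sums_occupancy[OF assms] this] show ?thesis
    by (simp add: state_law_simps)
qed

lemma occupancy_mixture:
  fixes \<pi> :: "real ^ 'a::finite ^ 's::finite"
  assumes "0 \<le> \<gamma>" "\<gamma> < 1" "\<pi> \<in> policies" "prob_vector p"
  shows "occupancy P \<gamma> \<pi> p s' = (\<Sum>s\<in>UNIV. p s * occupancy P \<gamma> \<pi> (pmf (return_pmf s)) s')"
proof -
  have "(\<lambda>t. (1 - \<gamma>) * (\<gamma> ^ t * state_law P \<pi> p t s'))
      = (\<lambda>t. \<Sum>s\<in>UNIV. p s * ((1 - \<gamma>) * (\<gamma> ^ t * state_law P \<pi> (pmf (return_pmf s)) t s')))"
    by (subst state_law_mixture) (simp add: fun_eq_iff sum_distrib_left mult_ac)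
  also have "\<dots> sums (\<Sum>s\<in>UNIV. p s * occupancy P \<gamma> \<pi> (pmf (return_pmf s)) s')"
    by (intro sums_sum sums_mult sums_occupancy assms prob_vector_pmf)
  finally show ?thesis
    using sums_occupancy[OF assms, of P s'] by (simp add: sums_unique2)
qed

lemma tendsto_state_law:
  fixes \<pi> :: "real ^ 'a::finite ^ 's::finite"
  assumes "(\<pi>' \<longlongrightarrow> \<pi>) F"
  shows "((\<lambda>h. state_law P (\<pi>' h) p t s) \<longlongrightarrow> state_law P \<pi> p t s) F"
  by (induction t arbitrary: s)
     (auto simp: state_law_simps transition_def intro!: tendsto_intros assms)

text \<open>Each term of the series is a polynomial in the policy, and \<open>\<gamma> ^ t\<close> dominates it on all policies.\<close>

lemma tendsto_occupancy:
  fixes \<pi> :: "real ^ 'a::finite ^ 's::finite"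
  assumes \<gamma>: "0 \<le> \<gamma>" "\<gamma> < 1" and p: "prob_vector p"
    and lim: "(\<pi>' \<longlongrightarrow> \<pi>) F" and pol: "eventually (\<lambda>h. \<pi>' h \<in> policies) F" and F: "F \<noteq> bot"
  shows "((\<lambda>h. occupancy P \<gamma> (\<pi>' h) p s) \<longlongrightarrow> occupancy P \<gamma> \<pi> p s) F"
proof -
  have "((\<lambda>h. \<Sum>t. \<gamma> ^ t * state_law P (\<pi>' h) p t s) \<longlongrightarrow> (\<Sum>t. \<gamma> ^ t * state_law P \<pi> p t s)) F"
  proof (rule tannerys_theorem[THEN conjunct2, THEN conjunct2])
    show "((\<lambda>h. \<gamma> ^ t * state_law P (\<pi>' h) p t s) \<longlongrightarrow> \<gamma> ^ t * state_law P \<pi> p t s) F" for t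
      by (intro tendsto_intros tendsto_state_law lim)
    show "\<forall>\<^sub>F (t, h) in at_top \<times>\<^sub>F F. norm (\<gamma> ^ t * state_law P (\<pi>' h) p t s) \<le> \<gamma> ^ t"
      by (rule eventually_mono[OF eventually_prodI[OF eventually_True pol]])
         (simp only: split_beta norm_discounted_state_law_le[OF \<gamma>(1) _ p])
    show "summable (\<lambda>t. \<gamma> ^ t)"
      using \<gamma> by (simp add: summable_geometric)
  qed (rule F)
  then show ?thesis
    unfolding occupancy_def by (rule tendsto_mult_left)
qed

section \<open>Reward and state frequency in terms of the occupancy\<close>

lemma sets_trajectory_law:
  assumes "\<pi> \<in> policies"
  shows "sets (trajectory_law P \<mu> \<pi>) = sets (PiM UNIV (\<lambda>_. count_space UNIV))"
proof -
  interpret IT: Ionescu_Tulcea "step_kernel P \<mu> \<pi>" "\<lambda>_. count_space UNIV"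
    by (rule Ionescu_Tulcea_step_kernel[OF assms])
  show ?thesis
    by (simp add: trajectory_law_def)
qed

lemma measurable_trajectory_component:
  assumes "\<pi> \<in> policies"
  shows "(\<lambda>\<omega>. \<omega> t) \<in> measurable (trajectory_law P \<mu> \<pi>) (count_space UNIV)"
  by (simp add: measurable_cong_sets[OF sets_trajectory_law[OF assms] refl]
      measurable_component_singleton)

lemma prob_space_trajectory_law:
  assumes "\<pi> \<in> policies"
  shows "prob_space (trajectory_law P \<mu> \<pi>)"
proof -
  interpret IT: Ionescu_Tulcea "step_kernel P \<mu> \<pi>" "\<lambda>_. count_space UNIV"
    by (rule Ionescu_Tulcea_step_kernel[OF assms])
  have "prob_space (distr IT.PF.lim (PiM {} (\<lambda>_. count_space UNIV)) (\<lambda>\<omega>. restrict \<omega> {}))"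
    using IT.PF.prob_space_P[of "{}"] by (simp add: IT.distr_lim)
  then show ?thesis
    unfolding trajectory_law_def
    by (rule prob_space_distrD[rotated])
       (auto simp: measurable_cong_sets[OF IT.PF.sets_lim refl] intro!: measurable_restrict)
qed

text \<open>Given the past, the next pair depends on the current one only, so the disintegration formula turns the
  law at time \<open>t\<close> into the law at time \<open>t + 1\<close>, and that step is the map \<open>transition\<close>.\<close>

lemma distr_trajectory_law:
  fixes \<pi> :: "real ^ 'a::finite ^ 's::finite"
  assumes \<pi>: "\<pi> \<in> policies"
  shows "distr (trajectory_law P \<mu> \<pi>) (count_space UNIV) (\<lambda>\<omega>. \<omega> t)
    = point_measure UNIV (\<lambda>(s, a). ennreal (state_law P \<pi> (pmf \<mu>) t s * \<pi> $ s $ a))"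
proof -
  interpret IT: Ionescu_Tulcea "step_kernel P \<mu> \<pi>" "\<lambda>_. count_space UNIV"
    by (rule Ionescu_Tulcea_step_kernel[OF \<pi>])
  let ?T = "trajectory_law P \<mu> \<pi>"
  have T: "?T = IT.PF.lim"
    by (simp add: trajectory_law_def)
  have nonneg: "0 \<le> state_law P \<pi> (pmf \<mu>) t s" "0 \<le> \<pi> $ s $ a" for t s a
    using prob_vector_state_law[OF \<pi> prob_vector_pmf] \<pi> by (auto simp: prob_vector_def policies_def)
  have meas: "(\<lambda>\<omega>. \<omega> t) \<in> measurable ?T (count_space UNIV)" for t
    by (rule measurable_trajectory_component[OF \<pi>])
  have eqI: "distr ?T (count_space UNIV) (\<lambda>\<omega>. \<omega> t) = point_measure UNIV g"
    if "\<And>x. (\<integral>\<^sup>+\<omega>. indicator {x} (\<omega> t) \<partial>?T) = g x" for t and g :: "'s \<times> 'a \<Rightarrow> ennreal"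
  proof (rule measure_eqI_finite[where A=UNIV])
    fix x
    have "emeasure (distr ?T (count_space UNIV) (\<lambda>\<omega>. \<omega> t)) {x}
        = (\<integral>\<^sup>+y. indicator {x} y \<partial>distr ?T (count_space UNIV) (\<lambda>\<omega>. \<omega> t))"
      by simp
    also have "\<dots> = (\<integral>\<^sup>+\<omega>. indicator {x} (\<omega> t) \<partial>?T)"
      by (rule nn_integral_distr[OF meas]) simp
    finally show "emeasure (distr ?T (count_space UNIV) (\<lambda>\<omega>. \<omega> t)) {x}
        = emeasure (point_measure UNIV g) {x}"
      by (simp add: that emeasure_point_measure_finite)
  qed (simp_all add: sets_point_measure)
  have sal: "(\<integral>\<^sup>+y. indicator {x} y \<partial>state_action_law \<pi> p) = ennreal (pmf p (fst x) * \<pi> $ fst x $ snd x)" for x p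
    by (simp add: state_action_law_def sets_point_measure emeasure_point_measure_finite split_beta)
  show ?thesis
  proof (induction t)
    case 0
    show ?case
    proof (rule eqI)
      fix x :: "'s \<times> 'a"
      have "emeasure ?T (space ?T) = 1"
        by (rule prob_space.emeasure_space_1[OF prob_space_trajectory_law[OF \<pi>]])
      then show "(\<integral>\<^sup>+\<omega>. indicator {x} (\<omega> 0) \<partial>?T)
          = (case x of (s, a) \<Rightarrow> ennreal (state_law P \<pi> (pmf \<mu>) 0 s * \<pi> $ s $ a))"
        using IT.nn_integral_lim_component[of "indicator {x}" 0] sal[of \<mu> x]
        by (simp add: T state_law_simps split_beta)
    qed
  next
    case (Suc t)
    show ?case
    proof (rule eqI)
      fix x :: "'s \<times> 'a"
      obtain s' a' where x: "x = (s', a')" by fastforce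
      have "(\<integral>\<^sup>+\<omega>. indicator {x} (\<omega> (Suc t)) \<partial>?T)
          = (\<integral>\<^sup>+\<omega>. ennreal (pmf (P (fst (\<omega> t)) (snd (\<omega> t))) s' * \<pi> $ s' $ a') \<partial>?T)"
        using IT.nn_integral_lim_component[of "indicator {x}" "Suc t"] sal[of _ x]
        by (simp add: T x)
      also have "\<dots> = (\<integral>\<^sup>+y. ennreal (pmf (P (fst y) (snd y)) s' * \<pi> $ s' $ a')
          \<partial>distr ?T (count_space UNIV) (\<lambda>\<omega>. \<omega> t))"
        by (rule nn_integral_distr[OF meas, symmetric]) simp
      also have "\<dots> = (\<Sum>y\<in>UNIV. ennreal ((state_law P \<pi> (pmf \<mu>) t (fst y) * \<pi> $ fst y $ snd y)
          * (pmf (P (fst y) (snd y)) s' * \<pi> $ s' $ a')))"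
        unfolding Suc by (subst nn_integral_point_measure_finite)
          (auto simp: split_beta ennreal_mult'[symmetric] nonneg mult_ac intro!: sum.cong)
      also have "\<dots> = ennreal (\<Sum>y\<in>UNIV. (state_law P \<pi> (pmf \<mu>) t (fst y) * \<pi> $ fst y $ snd y)
          * (pmf (P (fst y) (snd y)) s' * \<pi> $ s' $ a'))"
        by (intro sum_ennreal) (simp add: nonneg)
      also have "(\<Sum>y\<in>UNIV. (state_law P \<pi> (pmf \<mu>) t (fst y) * \<pi> $ fst y $ snd y)
          * (pmf (P (fst y) (snd y)) s' * \<pi> $ s' $ a')) = state_law P \<pi> (pmf \<mu>) (Suc t) s' * \<pi> $ s' $ a'"
        unfolding UNIV_Times_UNIV[symmetric] state_law_simps transition_def sum_distrib_left sum_distrib_right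
        by (simp add: sum.cartesian_product split_beta mult_ac)
      finally show "(\<integral>\<^sup>+\<omega>. indicator {x} (\<omega> (Suc t)) \<partial>?T)
          = (case x of (s, a) \<Rightarrow> ennreal (state_law P \<pi> (pmf \<mu>) (Suc t) s * \<pi> $ s $ a))"
        by (simp add: x)
    qed
  qed
qed

lemma expectation_trajectory_component:
  fixes \<pi> :: "real ^ 'a::finite ^ 's::finite" and f :: "'s \<times> 'a \<Rightarrow> real"
  assumes \<pi>: "\<pi> \<in> policies"
  shows "(\<integral>\<omega>. f (\<omega> t) \<partial>trajectory_law P \<mu> \<pi>)
    = (\<Sum>s\<in>UNIV. state_law P \<pi> (pmf \<mu>) t s * (\<Sum>a\<in>UNIV. \<pi> $ s $ a * f (s, a)))"
proof -
  have nonneg: "0 \<le> state_law P \<pi> (pmf \<mu>) t s" "0 \<le> \<pi> $ s $ a" for s a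
    using prob_vector_state_law[OF \<pi> prob_vector_pmf] \<pi> by (auto simp: prob_vector_def policies_def)
  have "(\<integral>\<omega>. f (\<omega> t) \<partial>trajectory_law P \<mu> \<pi>)
      = (\<integral>y. f y \<partial>distr (trajectory_law P \<mu> \<pi>) (count_space UNIV) (\<lambda>\<omega>. \<omega> t))"
    by (rule integral_distr[symmetric, OF measurable_trajectory_component[OF \<pi>]]) simp
  also have "\<dots> = (\<Sum>y\<in>UNIV. (case y of (s, a) \<Rightarrow> state_law P \<pi> (pmf \<mu>) t s * \<pi> $ s $ a) * f y)"
    unfolding distr_trajectory_law[OF \<pi>] split_beta
    by (subst lebesgue_integral_point_measure_finite) (simp_all add: nonneg)
  also have "\<dots> = (\<Sum>s\<in>UNIV. state_law P \<pi> (pmf \<mu>) t s * (\<Sum>a\<in>UNIV. \<pi> $ s $ a * f (s, a)))"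
    unfolding UNIV_Times_UNIV[symmetric] sum_distrib_left
    by (simp add: sum.cartesian_product split_beta mult_ac)
  finally show ?thesis .
qed

lemma state_frequency_eq_occupancy:
  fixes \<pi> :: "real ^ 'a::finite ^ 's::finite"
  assumes \<pi>: "\<pi> \<in> policies"
  shows "state_frequency P \<gamma> \<mu> \<pi> s = occupancy P \<gamma> \<pi> (pmf \<mu>) s"
proof -
  let ?T = "trajectory_law P \<mu> \<pi>"
  have "measure ?T {\<omega> \<in> space ?T. fst (\<omega> t) = s} = state_law P \<pi> (pmf \<mu>) t s" for t
  proof -
    have "measure ?T {\<omega> \<in> space ?T. fst (\<omega> t) = s}
        = (\<integral>\<omega>. indicator {\<omega> \<in> space ?T. fst (\<omega> t) = s} \<omega> \<partial>?T)"
      by (simp add: Int_absorb2)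
    also have "\<dots> = (\<integral>\<omega>. of_bool (fst (\<omega> t) = s) \<partial>?T)"
      by (intro Bochner_Integration.integral_cong) (auto simp: indicator_def)
    also have "\<dots> = (\<Sum>s'\<in>UNIV. state_law P \<pi> (pmf \<mu>) t s' * (\<Sum>a\<in>UNIV. \<pi> $ s' $ a * of_bool (s' = s)))"
      using expectation_trajectory_component[OF \<pi>, where f="\<lambda>y. of_bool (fst y = s)"] by simp
    also have "\<dots> = state_law P \<pi> (pmf \<mu>) t s"
      using \<pi> by (simp add: sum_distrib_right[symmetric] policies_def)
    finally show ?thesis .
  qed
  then show ?thesis
    by (simp add: state_frequency_def occupancy_def)
qed

text \<open>Rewards are bounded, so the discounted series converges absolutely and uniformly in the
  trajectory, and expectation commutes with it.\<close>

lemma reward_eq_occupancy: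
  fixes \<pi> :: "real ^ 'a::finite ^ 's::finite"
  assumes \<gamma>: "0 \<le> \<gamma>" "\<gamma> < 1" and \<pi>: "\<pi> \<in> policies"
  shows "reward P r \<gamma> \<mu> \<pi>
    = (\<Sum>s\<in>UNIV. occupancy P \<gamma> \<pi> (pmf \<mu>) s * (\<Sum>a\<in>UNIV. \<pi> $ s $ a * r $ s $ a))"
proof -
  let ?T = "trajectory_law P \<mu> \<pi>"
  let ?f = "\<lambda>t \<omega>. \<gamma> ^ t * r $ fst (\<omega> t) $ snd (\<omega> t)"
  interpret T: prob_space ?T
    by (rule prob_space_trajectory_law[OF \<pi>])
  define B where "B = (\<Sum>s\<in>UNIV. \<Sum>a\<in>UNIV. \<bar>r $ s $ a\<bar>)"
  have B: "\<bar>r $ s $ a\<bar> \<le> B" for s a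
  proof -
    have "\<bar>r $ s $ a\<bar> \<le> (\<Sum>a\<in>UNIV. \<bar>r $ s $ a\<bar>)"
      by (rule member_le_sum) auto
    also have "\<dots> \<le> B"
      unfolding B_def by (rule member_le_sum[where i=s]) (auto intro: sum_nonneg)
    finally show ?thesis .
  qed
  have bound: "norm (?f t \<omega>) \<le> \<gamma> ^ t * B" for t \<omega>
    using B \<gamma>(1) by (simp add: abs_mult mult_left_mono)
  have geometric: "summable (\<lambda>t. \<gamma> ^ t * B)"
    using \<gamma> by (intro summable_mult2 summable_geometric) simp
  have meas: "?f t \<in> borel_measurable ?T" for t
    using measurable_compose[OF measurable_trajectory_component[OF \<pi>],
        of "\<lambda>y. \<gamma> ^ t * r $ fst y $ snd y" borel] by simp
  have int: "integrable ?T (?f t)" for t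
    by (rule T.integrable_const_bound[OF _ meas]) (use bound in auto)
  have "(\<integral>\<omega>. norm (?f t \<omega>) \<partial>?T) \<le> \<gamma> ^ t * B" for t
    by (rule T.integral_le_const) (use int bound in auto)
  then have "summable (\<lambda>t. \<integral>\<omega>. norm (?f t \<omega>) \<partial>?T)"
    by (intro summable_comparison_test'[OF geometric, of 0]) (simp add: integral_nonneg_AE)
  moreover have "AE \<omega> in ?T. summable (\<lambda>t. norm (?f t \<omega>))"
    using bound by (intro AE_I2 summable_comparison_test'[OF geometric, of 0]) simp
  ultimately have "(\<integral>\<omega>. (\<Sum>t. ?f t \<omega>) \<partial>?T) = (\<Sum>t. \<integral>\<omega>. ?f t \<omega> \<partial>?T)"
    by (intro integral_suminf int)
  also have "\<dots> = (\<Sum>t. \<Sum>s\<in>UNIV. (\<gamma> ^ t * state_law P \<pi> (pmf \<mu>) t s) * (\<Sum>a\<in>UNIV. \<pi> $ s $ a * r $ s $ a))"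
    using expectation_trajectory_component[OF \<pi>, where f="\<lambda>y. r $ fst y $ snd y"]
    by (simp add: sum_distrib_left mult_ac)
  also have "\<dots> = (\<Sum>s\<in>UNIV. \<Sum>t. (\<gamma> ^ t * state_law P \<pi> (pmf \<mu>) t s) * (\<Sum>a\<in>UNIV. \<pi> $ s $ a * r $ s $ a))"
    by (intro suminf_sum summable_mult2 summable_discounted_state_law \<gamma> \<pi> prob_vector_pmf)
  also have "\<dots> = (\<Sum>s\<in>UNIV. (\<Sum>t. \<gamma> ^ t * state_law P \<pi> (pmf \<mu>) t s) * (\<Sum>a\<in>UNIV. \<pi> $ s $ a * r $ s $ a))"
    by (intro sum.cong refl suminf_mult2[symmetric] summable_discounted_state_law \<gamma> \<pi> prob_vector_pmf)
  finally show ?thesis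
    by (simp add: reward_def occupancy_def sum_distrib_left mult_ac)
qed

section \<open>Bellman equation and performance difference\<close>

lemma reward_eq_mean_state_value:
  fixes \<pi> :: "real ^ 'a::finite ^ 's::finite"
  assumes \<gamma>: "0 \<le> \<gamma>" "\<gamma> < 1" and \<pi>: "\<pi> \<in> policies" and p: "prob_vector p"
  shows "(\<Sum>s\<in>UNIV. occupancy P \<gamma> \<pi> p s * (\<Sum>a\<in>UNIV. \<pi> $ s $ a * r $ s $ a))
    = (\<Sum>s\<in>UNIV. p s * state_value P r \<gamma> \<pi> s)"
  unfolding state_value_def reward_eq_occupancy[OF \<gamma> \<pi>] sum_distrib_left
  by (subst occupancy_mixture[OF \<gamma> \<pi> p], unfold sum_distrib_right, subst (2) sum.swap, subst sum.swap)
     (simp add: mult_ac)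

lemma mean_action_value:
  fixes \<pi> :: "real ^ 'a::finite ^ 's::finite"
  shows "(\<Sum>a\<in>UNIV. \<pi>' $ s $ a * action_value P r \<gamma> \<pi> s a)
    = (1 - \<gamma>) * (\<Sum>a\<in>UNIV. \<pi>' $ s $ a * r $ s $ a)
      + \<gamma> * (\<Sum>s'\<in>UNIV. (\<Sum>a\<in>UNIV. \<pi>' $ s $ a * pmf (P s a) s') * state_value P r \<gamma> \<pi> s')"
proof -
  define X where "X a = (\<Sum>s'\<in>UNIV. state_value P r \<gamma> \<pi> s' * pmf (P s a) s')" for a
  have "(\<Sum>a\<in>UNIV. \<pi>' $ s $ a * action_value P r \<gamma> \<pi> s a)
      = (\<Sum>a\<in>UNIV. (1 - \<gamma>) * (\<pi>' $ s $ a * r $ s $ a) + \<gamma> * (\<pi>' $ s $ a * X a))"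
    unfolding action_value_def X_def[symmetric] by (simp add: algebra_simps)
  also have "\<dots> = (1 - \<gamma>) * (\<Sum>a\<in>UNIV. \<pi>' $ s $ a * r $ s $ a) + \<gamma> * (\<Sum>a\<in>UNIV. \<pi>' $ s $ a * X a)"
    by (simp only: sum.distrib sum_distrib_left)
  also have "(\<Sum>a\<in>UNIV. \<pi>' $ s $ a * X a)
      = (\<Sum>s'\<in>UNIV. (\<Sum>a\<in>UNIV. \<pi>' $ s $ a * pmf (P s a) s') * state_value P r \<gamma> \<pi> s')"
    unfolding X_def sum_distrib_left sum_distrib_right by (subst sum.swap) (simp add: mult_ac)
  finally show ?thesis .
qed

text \<open>The first-step form of the occupancy of the point mass at \<open>s\<close> splits the value into the immediate
  reward and the discounted reward of the process started in the law of the second state; the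
  latter is a mean of values by linearity.\<close>

lemma bellman_equation:
  fixes \<pi> :: "real ^ 'a::finite ^ 's::finite"
  assumes \<gamma>: "0 \<le> \<gamma>" "\<gamma> < 1" and \<pi>: "\<pi> \<in> policies"
  shows "(\<Sum>a\<in>UNIV. \<pi> $ s $ a * action_value P r \<gamma> \<pi> s a) = state_value P r \<gamma> \<pi> s"
proof -
  let ?\<delta> = "pmf (return_pmf s)" and ?r = "\<lambda>s. \<Sum>a\<in>UNIV. \<pi> $ s $ a * r $ s $ a"
  have \<delta>: "(\<Sum>s'\<in>UNIV. ?\<delta> s' * f s') = f s" for f :: "'s \<Rightarrow> real"
    by (simp add: pmf_return indicator_def)
  have "state_value P r \<gamma> \<pi> s = (\<Sum>s'\<in>UNIV. occupancy P \<gamma> \<pi> ?\<delta> s' * ?r s')"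
    by (simp add: state_value_def reward_eq_occupancy[OF \<gamma> \<pi>])
  also have "\<dots> = (1 - \<gamma>) * (\<Sum>s'\<in>UNIV. ?\<delta> s' * ?r s')
      + \<gamma> * (\<Sum>s'\<in>UNIV. occupancy P \<gamma> \<pi> (transition P \<pi> ?\<delta>) s' * ?r s')"
    by (subst occupancy_first_step[OF \<gamma> \<pi> prob_vector_pmf])
       (simp only: ring_distribs sum.distrib sum_distrib_left mult.assoc)
  also have "\<dots> = (1 - \<gamma>) * ?r s + \<gamma> * (\<Sum>s'\<in>UNIV. transition P \<pi> ?\<delta> s' * state_value P r \<gamma> \<pi> s')"
    unfolding \<delta>
    by (subst reward_eq_mean_state_value[OF \<gamma> \<pi>]) (simp_all add: prob_vector_transition \<pi> prob_vector_pmf)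
  also have "\<dots> = (\<Sum>a\<in>UNIV. \<pi> $ s $ a * action_value P r \<gamma> \<pi> s a)"
    unfolding mean_action_value transition_def \<delta> ..
  finally show ?thesis ..
qed

lemma mean_advantage_eq_0:
  fixes \<pi> :: "real ^ 'a::finite ^ 's::finite"
  assumes "0 \<le> \<gamma>" "\<gamma> < 1" and \<pi>: "\<pi> \<in> policies"
  shows "(\<Sum>a\<in>UNIV. \<pi> $ s $ a * advantage P r \<gamma> \<pi> s a) = 0"
proof -
  have "(\<Sum>a\<in>UNIV. \<pi> $ s $ a) = 1"
    using \<pi> by (simp add: policies_def)
  then show ?thesis
    by (simp add: advantage_def right_diff_distrib sum_subtractf bellman_equation[OF assms]
        sum_distrib_right[symmetric])
qed

text \<open>By the definition of the advantage, the right-hand side is \<open>(1 - \<gamma>) R(\<pi>')\<close> plus the integral of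
  \<open>V\<^sup>\<pi>\<close> against the signed vector \<open>\<gamma> (d\<^sup>\<pi>\<^sup>' after one step under \<pi>') - d\<^sup>\<pi>\<^sup>'\<close>. The flow equation says that
  this vector is \<open>-(1 - \<gamma>) \<mu>\<close>, and the mean of \<open>V\<^sup>\<pi>\<close> under \<open>\<mu>\<close> is \<open>R(\<pi>)\<close>.\<close>

lemma performance_difference:
  fixes \<pi> \<pi>' :: "real ^ 'a::finite ^ 's::finite"
  assumes \<gamma>: "0 \<le> \<gamma>" "\<gamma> < 1" and \<pi>: "\<pi> \<in> policies" and \<pi>': "\<pi>' \<in> policies"
  shows "(1 - \<gamma>) * (reward P r \<gamma> \<mu> \<pi>' - reward P r \<gamma> \<mu> \<pi>)
    = (\<Sum>s\<in>UNIV. occupancy P \<gamma> \<pi>' (pmf \<mu>) s * (\<Sum>a\<in>UNIV. \<pi>' $ s $ a * advantage P r \<gamma> \<pi> s a))"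
proof -
  let ?d = "occupancy P \<gamma> \<pi>' (pmf \<mu>)" and ?V = "state_value P r \<gamma> \<pi>"
    and ?r = "\<lambda>s. \<Sum>a\<in>UNIV. \<pi>' $ s $ a * r $ s $ a"
    and ?K = "\<lambda>s s'. \<Sum>a\<in>UNIV. \<pi>' $ s $ a * pmf (P s a) s'"
  have "(\<Sum>a\<in>UNIV. \<pi>' $ s $ a * advantage P r \<gamma> \<pi> s a)
      = (1 - \<gamma>) * ?r s + \<gamma> * (\<Sum>s'\<in>UNIV. ?K s s' * ?V s') - ?V s" for s
    using \<pi>' by (simp add: advantage_def right_diff_distrib sum_subtractf mean_action_value
        sum_distrib_right[symmetric] policies_def)
  then have "(\<Sum>s\<in>UNIV. ?d s * (\<Sum>a\<in>UNIV. \<pi>' $ s $ a * advantage P r \<gamma> \<pi> s a))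
      = (1 - \<gamma>) * (\<Sum>s\<in>UNIV. ?d s * ?r s)
        + \<gamma> * (\<Sum>s\<in>UNIV. ?d s * (\<Sum>s'\<in>UNIV. ?K s s' * ?V s')) - (\<Sum>s\<in>UNIV. ?d s * ?V s)"
    by (simp only: ring_distribs sum.distrib sum_subtractf sum_distrib_left[where 'b='s] mult.left_commute)
  also have "(\<Sum>s\<in>UNIV. ?d s * (\<Sum>s'\<in>UNIV. ?K s s' * ?V s'))
      = (\<Sum>s'\<in>UNIV. transition P \<pi>' ?d s' * ?V s')"
    unfolding transition_def sum_distrib_left[of "?d _"] sum_distrib_right[of _ _ "?V _"]
    by (subst sum.swap) (simp add: mult_ac)
  also have "(\<Sum>s\<in>UNIV. ?d s * ?V s)
      = (1 - \<gamma>) * (\<Sum>s\<in>UNIV. pmf \<mu> s * ?V s) + \<gamma> * (\<Sum>s\<in>UNIV. transition P \<pi>' ?d s * ?V s)"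
    by (subst occupancy_flow[OF \<gamma> \<pi>' prob_vector_pmf])
       (simp only: ring_distribs sum.distrib sum_distrib_left mult.assoc)
  also have "(\<Sum>s\<in>UNIV. pmf \<mu> s * ?V s) = reward P r \<gamma> \<mu> \<pi>"
    by (simp add: reward_eq_occupancy[OF \<gamma> \<pi>] reward_eq_mean_state_value[OF \<gamma> \<pi> prob_vector_pmf])
  finally show ?thesis
    by (simp add: reward_eq_occupancy[OF \<gamma> \<pi>', of P r \<mu>] right_diff_distrib)
qed

section \<open>The policy gradient and the Kakade metric\<close>

lemma convex_policies: "convex (policies :: (real ^ 'a::finite ^ 's::finite) set)"
  by (rule convexI)
     (simp add: policies_def sum.distrib sum_distrib_left[symmetric])

text \<open>A segment from any policy to a relative interior point can be prolonged inside the set of policies.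
  Applied to the uniform policy, prolongation beyond a vanishing entry would make it negative.\<close>

lemma int_policies_pos:
  fixes \<pi> :: "real ^ 'a::finite ^ 's::finite"
  assumes "\<pi> \<in> int_policies"
  shows "0 < \<pi> $ s $ a"
proof -
  define u :: "real ^ 'a ^ 's" where "u = (\<chi> s a. 1 / real CARD('a))"
  have u: "u \<in> policies"
    by (simp add: policies_def u_def)
  then have "(policies :: (real ^ 'a ^ 's) set) \<noteq> {}"
    by blast
  with assms u obtain e where e: "e > 1" "(1 - e) *\<^sub>R u + e *\<^sub>R \<pi> \<in> policies"
    unfolding convex_rel_interior_iff[OF convex_policies \<open>policies \<noteq> {}\<close>] by blast
  then have "0 \<le> ((1 - e) *\<^sub>R u + e *\<^sub>R \<pi>) $ s $ a"
    unfolding policies_def by blast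
  then have "(e - 1) / real CARD('a) \<le> e * \<pi> $ s $ a"
    by (simp add: u_def diff_divide_distrib)
  moreover have "0 < (e - 1) / real CARD('a)"
    using e by simp
  ultimately have "0 < e * \<pi> $ s $ a"
    by linarith
  with e show ?thesis
    by (simp add: zero_less_mult_iff)
qed

lemma eventually_policy_along_tangent:
  fixes \<pi> w :: "real ^ 'a::finite ^ 's::finite"
  assumes \<pi>: "\<pi> \<in> policies" and pos: "\<And>s a. 0 < \<pi> $ s $ a" and w: "w \<in> tangent_space"
  shows "\<forall>\<^sub>F t in at 0. \<pi> + t *\<^sub>R w \<in> policies"
proof -
  have "\<forall>\<^sub>F t in at 0. 0 < \<pi> $ s $ a + t * w $ s $ a" for s a
  proof (rule order_tendstoD(1)[OF _ pos[of s a]])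
    have "((\<lambda>t. \<pi> $ s $ a + t * w $ s $ a) \<longlongrightarrow> \<pi> $ s $ a + 0 * w $ s $ a) (at 0)"
      by (intro tendsto_intros)
    then show "((\<lambda>t. \<pi> $ s $ a + t * w $ s $ a) \<longlongrightarrow> \<pi> $ s $ a) (at 0)"
      by simp
  qed
  then have "\<forall>\<^sub>F t in at 0. \<forall>s a. 0 < \<pi> $ s $ a + t * w $ s $ a"
    by (intro eventually_all_finite)
  then show ?thesis
  proof eventually_elim
    case (elim t)
    then show ?case
      using \<pi> w by (auto simp: policies_def tangent_space_def sum.distrib sum_distrib_left[symmetric] less_imp_le)
  qed
qed

text \<open>The difference quotient equals \<open>(1 - \<gamma>)\<^sup>-\<^sup>1 \<Sum>\<^sub>s d(s) \<Sum>\<^sub>a w(s, a) A\<^sup>\<pi>(s, a)\<close> exactly, where \<open>d\<close> is the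
  occupancy of the perturbed policy, so the limit only moves the occupancy.\<close>

lemma policy_gradient:
  fixes \<pi> w :: "real ^ 'a::finite ^ 's::finite"
  assumes \<gamma>: "0 \<le> \<gamma>" "\<gamma> < 1" and \<pi>: "\<pi> \<in> policies" and pos: "\<And>s a. 0 < \<pi> $ s $ a"
    and w: "w \<in> tangent_space"
  shows "((\<lambda>t. reward P r \<gamma> \<mu> (\<pi> + t *\<^sub>R w)) has_real_derivative
    inverse (1 - \<gamma>) * (\<Sum>s\<in>UNIV. occupancy P \<gamma> \<pi> (pmf \<mu>) s
      * (\<Sum>a\<in>UNIV. w $ s $ a * advantage P r \<gamma> \<pi> s a))) (at 0)"
proof -
  let ?d = "\<lambda>t. occupancy P \<gamma> (\<pi> + t *\<^sub>R w) (pmf \<mu>)"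
    and ?W = "\<lambda>s. \<Sum>a\<in>UNIV. w $ s $ a * advantage P r \<gamma> \<pi> s a"
  note pol = eventually_policy_along_tangent[OF \<pi> pos w]
  have "((\<lambda>t. \<pi> + t *\<^sub>R w) \<longlongrightarrow> \<pi> + 0 *\<^sub>R w) (at 0)"
    by (intro tendsto_intros)
  then have "((\<lambda>t. \<pi> + t *\<^sub>R w) \<longlongrightarrow> \<pi>) (at 0)"
    by simp
  then have "((\<lambda>t. ?d t s) \<longlongrightarrow> occupancy P \<gamma> \<pi> (pmf \<mu>) s) (at 0)" for s
    by (intro tendsto_occupancy \<gamma> prob_vector_pmf pol) simp_all
  then have "((\<lambda>t. inverse (1 - \<gamma>) * (\<Sum>s\<in>UNIV. ?d t s * ?W s))
      \<longlongrightarrow> inverse (1 - \<gamma>) * (\<Sum>s\<in>UNIV. occupancy P \<gamma> \<pi> (pmf \<mu>) s * ?W s)) (at 0)"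
    by (intro tendsto_intros)
  moreover have "\<forall>\<^sub>F t in at 0. inverse (1 - \<gamma>) * (\<Sum>s\<in>UNIV. ?d t s * ?W s)
      = (reward P r \<gamma> \<mu> (\<pi> + t *\<^sub>R w) - reward P r \<gamma> \<mu> \<pi>) / t"
    using pol eventually_neq_at_within[of 0]
  proof eventually_elim
    case (elim t)
    have "(\<Sum>a\<in>UNIV. (\<pi> + t *\<^sub>R w) $ s $ a * advantage P r \<gamma> \<pi> s a) = t * ?W s" for s
      using mean_advantage_eq_0[OF \<gamma> \<pi>, of s P r]
      by (simp add: ring_distribs sum.distrib sum_distrib_left mult.assoc)
    then have "(1 - \<gamma>) * (reward P r \<gamma> \<mu> (\<pi> + t *\<^sub>R w) - reward P r \<gamma> \<mu> \<pi>)
        = t * (\<Sum>s\<in>UNIV. ?d t s * ?W s)"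
      unfolding performance_difference[OF \<gamma> \<pi> elim(1)] sum_distrib_left[of t "\<lambda>s. ?d t s * ?W s"]
      by (simp only: mult.left_commute)
    then show ?case
      using elim \<gamma> by (simp add: field_simps)
  qed
  ultimately show ?thesis
    unfolding DERIV_def by (simp add: tendsto_cong)
qed

lemma kakade_metric_definite:
  assumes d: "\<And>s. 0 < state_frequency P \<gamma> \<mu> \<pi> s" and pos: "\<And>s a. 0 < \<pi> $ s $ a"
    and zero: "kakade_metric P \<gamma> \<mu> \<pi> w w = 0"
  shows "w = 0"
proof -
  have nonneg: "0 \<le> w $ s $ a * w $ s $ a / \<pi> $ s $ a" for s a
    using pos[of s a] by simp
  have product_0: "state_frequency P \<gamma> \<mu> \<pi> s * (\<Sum>a\<in>UNIV. w $ s $ a * w $ s $ a / \<pi> $ s $ a) = 0" for s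
  proof -
    have "\<forall>s\<in>UNIV. state_frequency P \<gamma> \<mu> \<pi> s * (\<Sum>a\<in>UNIV. w $ s $ a * w $ s $ a / \<pi> $ s $ a) = 0"
      using zero unfolding kakade_metric_def
      by (subst (asm) sum_nonneg_eq_0_iff) (auto intro!: mult_nonneg_nonneg sum_nonneg nonneg less_imp_le[OF d])
    then show ?thesis by simp
  qed
  have "(\<Sum>a\<in>UNIV. w $ s $ a * w $ s $ a / \<pi> $ s $ a) = 0" for s
    using product_0[of s] d[THEN less_imp_neq, of s] by simp
  then have term_0: "w $ s $ a * w $ s $ a / \<pi> $ s $ a = 0" for s a
    using nonneg by (subst (asm) sum_nonneg_eq_0_iff) auto
  have "w $ s $ a = 0" for s a
    using term_0[of s a] pos[THEN less_imp_neq, of s a] by simp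
  then show ?thesis
    by (simp add: vec_eq_iff)
qed

lemma kakade_metric_diff_left:
  "kakade_metric P \<gamma> \<mu> \<pi> (v - v') w = kakade_metric P \<gamma> \<mu> \<pi> v w - kakade_metric P \<gamma> \<mu> \<pi> v' w"
  by (simp add: kakade_metric_def left_diff_distrib diff_divide_distrib sum_subtractf right_diff_distrib)

lemma is_kakade_gradient_unique:
  assumes d: "\<And>s. 0 < state_frequency P \<gamma> \<mu> \<pi> s" and pos: "\<And>s a. 0 < \<pi> $ s $ a"
    and v: "is_kakade_gradient P r \<gamma> \<mu> \<pi> v" and v': "is_kakade_gradient P r \<gamma> \<mu> \<pi> v'"
  shows "v = v'"
proof -
  have "v - v' \<in> tangent_space"
    using v v' by (simp add: is_kakade_gradient_def tangent_space_def sum_subtractf)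
  then have "kakade_metric P \<gamma> \<mu> \<pi> v (v - v') = kakade_metric P \<gamma> \<mu> \<pi> v' (v - v')"
    using v v' DERIV_unique unfolding is_kakade_gradient_def by blast
  then have "kakade_metric P \<gamma> \<mu> \<pi> (v - v') (v - v') = 0"
    by (simp add: kakade_metric_diff_left)
  from kakade_metric_definite[OF d pos this] show ?thesis
    by simp
qed

text \<open>The factor \<open>\<pi>(a|s)\<close> cancels the denominator in the metric, which turns the policy gradient formula into
  a Kakade product.\<close>

lemma is_kakade_gradient_advantage:
  fixes \<pi> :: "real ^ 'a::finite ^ 's::finite"
  assumes \<gamma>: "0 \<le> \<gamma>" "\<gamma> < 1" and \<pi>: "\<pi> \<in> policies" and pos: "\<And>s a. 0 < \<pi> $ s $ a"
  shows "is_kakade_gradient P r \<gamma> \<mu> \<pi>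
    (\<chi> s a. inverse (1 - \<gamma>) * advantage P r \<gamma> \<pi> s a * \<pi> $ s $ a)"
    (is "is_kakade_gradient _ _ _ _ _ ?v")
proof -
  have "(\<Sum>a\<in>UNIV. ?v $ s $ a)
      = inverse (1 - \<gamma>) * (\<Sum>a\<in>UNIV. \<pi> $ s $ a * advantage P r \<gamma> \<pi> s a)" for s
    unfolding sum_distrib_left by (rule sum.cong) simp_all
  then have "?v \<in> tangent_space"
    unfolding tangent_space_def mean_advantage_eq_0[OF \<gamma> \<pi>] by simp
  moreover have "kakade_metric P \<gamma> \<mu> \<pi> ?v w = inverse (1 - \<gamma>) * (\<Sum>s\<in>UNIV. occupancy P \<gamma> \<pi> (pmf \<mu>) s
      * (\<Sum>a\<in>UNIV. w $ s $ a * advantage P r \<gamma> \<pi> s a))" for w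
  proof -
    have inner: "(\<Sum>a\<in>UNIV. ?v $ s $ a * w $ s $ a / \<pi> $ s $ a)
        = inverse (1 - \<gamma>) * (\<Sum>a\<in>UNIV. w $ s $ a * advantage P r \<gamma> \<pi> s a)" for s
      unfolding sum_distrib_left using pos[of s, THEN less_imp_neq]
      by (intro sum.cong refl) (simp add: eq_commute[of 0])
    show ?thesis
      unfolding kakade_metric_def inner state_frequency_eq_occupancy[OF \<pi>]
      by (simp only: mult.left_commute sum_distrib_left[of "inverse (1 - \<gamma>)" _ "UNIV :: 's set"])
  qed
  ultimately show ?thesis
    using policy_gradient[OF \<gamma> \<pi> pos, of _ P r \<mu>] by (simp add: is_kakade_gradient_def)
qed

theorem theorem3p3:
  fixes P :: "'s::finite \<Rightarrow> 'a::finite \<Rightarrow> 's pmf"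
    and r :: "real ^ 'a ^ 's"
    and \<gamma> :: real
    and \<mu> :: "'s pmf"
  assumes discount: "0 \<le> \<gamma>" "\<gamma> < 1"
    and exploration: "\<forall>\<pi>\<in>int_policies. \<forall>s. state_frequency P \<gamma> \<mu> \<pi> s > 0"
  shows "\<forall>\<pi>\<in>int_policies. \<forall>s a.
    kakade_gradient P r \<gamma> \<mu> \<pi> $ s $ a = inverse (1 - \<gamma>) * advantage P r \<gamma> \<pi> s a * \<pi> $ s $ a"
proof (intro ballI allI)
  fix \<pi> :: "real ^ 'a ^ 's" and s a
  assume int: "\<pi> \<in> int_policies"
  then have \<pi>: "\<pi> \<in> policies" and pos: "\<And>s a. 0 < \<pi> $ s $ a"
    using rel_interior_subset int_policies_pos by blast+
  have d: "\<And>s. 0 < state_frequency P \<gamma> \<mu> \<pi> s"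
    using exploration int by blast
  note grad = is_kakade_gradient_advantage[OF discount \<pi> pos, of P r \<mu>]
  have "kakade_gradient P r \<gamma> \<mu> \<pi> = (\<chi> s a. inverse (1 - \<gamma>) * advantage P r \<gamma> \<pi> s a * \<pi> $ s $ a)"
    unfolding kakade_gradient_def
    using grad by (rule the_equality) (rule is_kakade_gradient_unique[OF d pos _ grad])
  then show "kakade_gradient P r \<gamma> \<mu> \<pi> $ s $ a
      = inverse (1 - \<gamma>) * advantage P r \<gamma> \<pi> s a * \<pi> $ s $ a"
    by simp
qed

end
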